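(* Let $n\ge 1$. If $(a_1,a_2,\dots,a_n)$ is a weakly decreasing parking function, then it is a frustrated parking function. Consequently, there are $\frac{1}{n+1}\binom{2n}{n}$ weakly decreasing frustrated parking functions of length $n$.
   Context: Let $n\ge 1$ and $[n]=\{1,2,\dots,n\}$. There are $n$ cars and $n$ parking spots numbered $1,\dots,n$, all initially empty, and cars $1,2,\dots,n$ enter in this order with preferences $(a_1,\dots,a_n)\in[n]^n$. Classical rule: if spot $a_i$ is unoccupied when car $i$ enters, it parks there; otherwise it parks in the smallest-numbered unoccupied spot greater than $a_i$, if one exists, and cannot park if none exists. The sequence is a (classical) parking function of length $n$ if all cars can park under this rule. Frustrated rule: if spot $a_i$ is unoccupied when car $i$ enters, it parks there; otherwise it parks in the largest-numbered unoccupied spot greater than $a_i$, if one exists, and cannot park if none exists. The sequence is a frustrated parking function of length $n$ if all cars can park under this rule. A sequence is weakly decreasing if $a_1\ge a_2\ge\cdots\ge a_n$. *)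

theory Defs
  imports Complex_Main
begin

text \<open>Spots are numbered from 1; \<open>S\<close> is the set of occupied spots.\<close>

definition free_above :: "nat \<Rightarrow> nat set \<Rightarrow> nat \<Rightarrow> nat set" where
  "free_above n S a = {s \<in> {1..n}. s \<notin> S \<and> a < s}"

text \<open>A parking rule returns the spot taken by a car with preference \<open>a\<close>, or \<open>None\<close> if the car
  cannot park.\<close>

definition classical_rule :: "nat \<Rightarrow> nat set \<Rightarrow> nat \<Rightarrow> nat option" where
  "classical_rule n S a =
     (if a \<notin> S then Some a
      else if free_above n S a \<noteq> {} then Some (Min (free_above n S a))
      else None)"

definition frustrated_rule :: "nat \<Rightarrow> nat set \<Rightarrow> nat \<Rightarrow> nat option" where
  "frustrated_rule n S a =
     (if a \<notin> S then Some a
      else if free_above n S a \<noteq> {} then Some (Max (free_above n S a))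
      else None)"

fun all_park :: "(nat set \<Rightarrow> nat \<Rightarrow> nat option) \<Rightarrow> nat set \<Rightarrow> nat list \<Rightarrow> bool" where
  "all_park rule S [] = True"
| "all_park rule S (a # as) =
     (case rule S a of None \<Rightarrow> False | Some s \<Rightarrow> all_park rule (insert s S) as)"

definition preferences :: "nat \<Rightarrow> nat list set" where
  "preferences n = {as. length as = n \<and> set as \<subseteq> {1..n}}"

definition parking_function :: "nat \<Rightarrow> nat list \<Rightarrow> bool" where
  "parking_function n as \<longleftrightarrow> as \<in> preferences n \<and> all_park (classical_rule n) {} as"

definition frustrated_parking_function :: "nat \<Rightarrow> nat list \<Rightarrow> bool" where
  "frustrated_parking_function n as \<longleftrightarrow>
     as \<in> preferences n \<and> all_park (frustrated_rule n) {} as"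

abbreviation weakly_decreasing :: "nat list \<Rightarrow> bool" where
  "weakly_decreasing as \<equiv> sorted_wrt (\<ge>) as"

end

theory Submission
  imports Defs
begin

text \<open>
  When preferences arrive in weakly decreasing order, every spot occupied so far lies at or above
  the preference \<open>a\<close> of the next car, because a car never parks below its own preference. So the
  occupied spots form a subset \<open>S\<close> of \<open>{a..n}\<close>, and the next car fails exactly when \<open>S\<close> is all of
  \<open>{a..n}\<close>. This depends on \<open>card S\<close> only, that is, on the number of earlier cars, and not on
  which free spots those cars chose. Hence \<^emph>\<open>every\<close> rule that sends a car to some free spot at or
  above its preference whenever there is one accepts the same weakly decreasing sequences, namely
  those that stay below the staircase \<open>n, n - 1, \<dots>, 1\<close> (lemma \<open>all_park_decreasing_iff\<close>). The
  classical and the frustrated rule are both of this kind.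

  It remains to count the weakly decreasing sequences below the staircase. Bounding the entries by
  a second parameter and splitting off a maximal first entry gives the recurrence of the Catalan
  triangle, which is solved by a difference of two binomial coefficients, as in the reflection
  principle for ballot paths (lemma \<open>card_staircase\<close>). The diagonal of the triangle consists of the
  Catalan numbers.
\<close>

text \<open>The property that the two rules share. The preferred spot itself is treated like any other
  spot in \<open>{a..n}\<close>: a car may skip it even when it is free.\<close>

definition forward_rule :: "nat \<Rightarrow> (nat set \<Rightarrow> nat \<Rightarrow> nat option) \<Rightarrow> bool" where
  "forward_rule n rule \<longleftrightarrow>
     (\<forall>S. \<forall>a \<in> {1..n}. case rule S a of None \<Rightarrow> {a..n} \<subseteq> S | Some s \<Rightarrow> s \<in> {a..n} - S)"

text \<open>The classical and the frustrated rule differ only in how an occupied preference is resolved;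
  any choice function in place of \<open>Min\<close> and \<open>Max\<close> gives a forward rule.\<close>

lemma forward_rule_pick:
  assumes "\<And>F. finite F \<Longrightarrow> F \<noteq> {} \<Longrightarrow> pick F \<in> F"
  shows "forward_rule n (\<lambda>S a. if a \<notin> S then Some a
      else if free_above n S a \<noteq> {} then Some (pick (free_above n S a)) else None)"
proof -
  have "pick (free_above n S a) \<in> {a..n} - S" if "free_above n S a \<noteq> {}" for S a
  proof -
    have "pick (free_above n S a) \<in> free_above n S a"
      using that by (intro assms) (auto simp: free_above_def)
    then show ?thesis
      by (auto simp: free_above_def)
  qed
  moreover have "{a..n} \<subseteq> S" if "a \<in> S" "a \<in> {1..n}" "free_above n S a = {}" for S a
  proof
    fix s
    assume "s \<in> {a..n}"
    then show "s \<in> S"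
      using that by (cases "s = a") (auto simp: free_above_def)
  qed
  moreover have "a \<in> {a..n}" if "a \<in> {1..n}" for a
    using that by simp
  ultimately show ?thesis
    unfolding forward_rule_def by (auto simp del: atLeastAtMost_iff)
qed

lemma forward_rule_classical: "forward_rule n (classical_rule n)"
  using forward_rule_pick[of Min n] by (simp add: classical_rule_def[abs_def])

lemma forward_rule_frustrated: "forward_rule n (frustrated_rule n)"
  using forward_rule_pick[of Max n] by (simp add: frustrated_rule_def[abs_def])

text \<open>If the first car is turned away, then \<open>S\<close> fills \<open>{a..n}\<close> and \<open>a + card S\<close> exceeds \<open>n\<close>. If it
  parks, then \<open>S\<close> together with its spot is a subset of \<open>{a..n}\<close> with \<open>card S + 1\<close> elements, so
  \<open>a + card S\<close> is at most \<open>n\<close>; and the enlarged set again lies at or above all later preferences. So the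
  inequality for the first car decides its fate, and induction treats the others.\<close>

lemma all_park_decreasing_iff:
  assumes "forward_rule n rule" "weakly_decreasing as" "set as \<subseteq> {1..n}"
    and "S \<subseteq> {1..n}" "\<forall>a \<in> set as. S \<subseteq> {a..n}"
  shows "all_park rule S as \<longleftrightarrow> (\<forall>i < length as. as ! i + card S + i \<le> n)"
  using assms(2-)
proof (induction as arbitrary: S)
  case Nil
  then show ?case by simp
next
  case (Cons a as)
  have a: "a \<in> {1..n}" and S: "S \<subseteq> {a..n}"
    using Cons.prems by auto
  have fin: "finite S"
    using S finite_subset by blast
  have rule: "case rule S a of None \<Rightarrow> {a..n} \<subseteq> S | Some s \<Rightarrow> s \<in> {a..n} - S"
    using assms(1) a unfolding forward_rule_def by blast
  show ?case
  proof (cases "rule S a")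
    case None
    then have "{a..n} \<subseteq> S"
      using rule by simp
    then have "card {a..n} \<le> card S"
      by (rule card_mono[OF fin])
    then have "\<not> a + card S \<le> n"
      using a by auto
    then show ?thesis
      using None by (auto intro!: exI[of _ 0])
  next
    case (Some s)
    then have s: "s \<in> {a..n}" "s \<notin> S"
      using rule by simp_all
    have card_insert: "card (insert s S) = Suc (card S)"
      using fin s by simp
    have "card (insert s S) \<le> card {a..n}"
      using S s by (intro card_mono) auto
    then have room: "a + card S \<le> n"
      using card_insert a by auto
    have "all_park rule (insert s S) as
        \<longleftrightarrow> (\<forall>i < length as. as ! i + card (insert s S) + i \<le> n)"
    proof (rule Cons.IH)
      show "\<forall>b \<in> set as. insert s S \<subseteq> {b..n}"
        using Cons.prems s by force
    qed (use Cons.prems s a in auto)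
    then show ?thesis
      using Some room card_insert by (simp add: All_less_Suc2)
  qed
qed

text \<open>The bound is \<open>b + 1\<close> rather than \<open>b\<close> so that the recurrence below starts from
  \<open>card (staircase m 0) = 1\<close> and \<open>b\<close> ranges over \<open>0..m\<close>, as in the Catalan triangle.\<close>

definition staircase :: "nat \<Rightarrow> nat \<Rightarrow> nat list set" where
  "staircase m b = {as. length as = m \<and> weakly_decreasing as \<and> set as \<subseteq> {1..Suc b}
     \<and> (\<forall>i < m. as ! i + i \<le> m)}"

lemma parks_decreasing_iff_staircase:
  assumes "forward_rule n rule"
  shows "weakly_decreasing as \<and> as \<in> preferences n \<and> all_park rule {} as \<longleftrightarrow> as \<in> staircase n n"
proof -
  have "set as \<subseteq> {1..n}" if "as \<in> staircase n n"
    using that by (fastforce simp: staircase_def in_set_conv_nth)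
  then show ?thesis
    using all_park_decreasing_iff[OF assms, of as "{}"]
    by (auto simp: staircase_def preferences_def)
qed

lemma finite_staircase: "finite (staircase m b)"
  by (rule finite_subset[OF _ finite_lists_length_eq[of "{1..Suc b}" m]])
     (auto simp: staircase_def)

lemma staircase_0: "staircase 0 b = {[]}"
  by (auto simp: staircase_def)

text \<open>In a weakly decreasing sequence the first entry \<open>a\<close> bounds all others, and removing it
  lowers the staircase by one step. The second argument \<open>a - 1\<close> encodes the bound \<open>a\<close>.\<close>

lemma staircase_Suc:
  "staircase (Suc m) b = (\<Union>a \<in> {1..min (Suc b) (Suc m)}. (#) a ` staircase m (a - 1))"
    (is "_ = ?R")
proof -
  have "as \<in> staircase (Suc m) b \<longleftrightarrow> as \<in> ?R" for as
  proof (cases as)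
    case Nil
    then show ?thesis
      by (auto simp: staircase_def)
  next
    case (Cons a as')
    have "a # as' \<in> staircase (Suc m) b
        \<longleftrightarrow> a \<in> {1..min (Suc b) (Suc m)} \<and> as' \<in> staircase m (a - 1)"
      by (auto simp: staircase_def All_less_Suc2 subset_iff)
    then show ?thesis
      using Cons by blast
  qed
  then show ?thesis
    by blast
qed

lemma staircase_Suc_0: "staircase (Suc m) 0 = (#) 1 ` staircase m 0"
  by (simp add: staircase_Suc)

lemma staircase_Suc_Suc:
  assumes "b < m"
  shows "staircase (Suc m) (Suc b)
    = staircase (Suc m) b \<union> (#) (Suc (Suc b)) ` staircase m (Suc b)"
proof -
  have "{1..min (Suc (Suc b)) (Suc m)} = insert (Suc (Suc b)) {1..min (Suc b) (Suc m)}"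
    using assms by auto
  then show ?thesis
    unfolding staircase_Suc by auto
qed

lemma staircase_Suc_diagonal: "staircase (Suc m) (Suc m) = staircase (Suc m) m"
  by (simp add: staircase_Suc)

lemma card_staircase_Suc_0: "card (staircase (Suc m) 0) = card (staircase m 0)"
  by (simp add: staircase_Suc_0 card_image)

lemma card_staircase_Suc_Suc:
  assumes "b < m"
  shows "card (staircase (Suc m) (Suc b)) = card (staircase (Suc m) b) + card (staircase m (Suc b))"
proof -
  have "staircase (Suc m) b \<inter> (#) (Suc (Suc b)) ` staircase m (Suc b) = {}"
    by (auto simp: staircase_def)
  then show ?thesis
    by (simp add: staircase_Suc_Suc[OF assms] card_Un_disjoint finite_staircase card_image)
qed

text \<open>Both sides satisfy the same recurrence: inside the triangle it is Pascal's rule, and on the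
  diagonal \<open>b = m\<close>, where the staircase already enforces the bound, it is the symmetry of row
  \<open>2 * m - 1\<close> of Pascal's triangle. Adding the second binomial coefficient on the left avoids
  truncated subtraction.\<close>

lemma card_staircase:
  assumes "b \<le> m"
  shows "card (staircase m b) + (m + b choose Suc m) = (m + b choose m)"
  using assms
proof (induction m arbitrary: b)
  case 0
  then show ?case by (simp add: staircase_0)
next
  case (Suc m)
  note outer_IH = Suc.IH
  from Suc.prems show ?case
  proof (induction b)
    case 0
    then show ?case
      using outer_IH[of 0] by (simp add: card_staircase_Suc_0 binomial_eq_0)
  next
    case (Suc b)
    note left = Suc.IH[OF Suc_leD[OF Suc.prems]]
    show ?case
    proof (cases "b = m")
      case True
      have "(Suc (m + m) choose m) = (Suc (m + m) choose Suc m)"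
        using binomial_symmetric[of m "Suc (m + m)"] by simp
      then show ?thesis
        using left True by (simp add: staircase_Suc_diagonal)
    next
      case False
      then have "b < m"
        using Suc.prems by simp
      then show ?thesis
        using left outer_IH[of "Suc b"] by (simp add: card_staircase_Suc_Suc)
    qed
  qed
qed

text \<open>The Catalan number, since
  \<open>(n + 1) * (2 * n choose n + 1) = n * (2 * n choose n)\<close>.\<close>

lemma card_staircase_diagonal:
  "(n + 1) * card (staircase n n) = (2 * n choose n)"
proof -
  have absorb: "Suc n * (2 * n choose Suc n) = n * (2 * n choose n)"
    using trans[OF binomial_absorption[of n "2 * n"] binomial_absorb_comp[of "2 * n" n, symmetric]]
    by simp
  have "Suc n * (card (staircase n n) + (2 * n choose Suc n)) = Suc n * (2 * n choose n)"
    using card_staircase[of n n] by (simp add: mult_2)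
  then show ?thesis
    using absorb by (simp add: algebra_simps)
qed

theorem proposition2p6:
  fixes n :: nat
  assumes "n \<ge> 1"
  shows "(\<forall>as. weakly_decreasing as \<and> parking_function n as \<longrightarrow> frustrated_parking_function n as)
    \<and> real (card {as. weakly_decreasing as \<and> frustrated_parking_function n as})
        = 1 / (real n + 1) * real ((2 * n) choose n)"
proof
  show "\<forall>as. weakly_decreasing as \<and> parking_function n as \<longrightarrow> frustrated_parking_function n as"
    using parks_decreasing_iff_staircase[OF forward_rule_classical]
      parks_decreasing_iff_staircase[OF forward_rule_frustrated]
    by (auto simp: parking_function_def frustrated_parking_function_def)
  have "{as. weakly_decreasing as \<and> frustrated_parking_function n as} = staircase n n"
    using parks_decreasing_iff_staircase[OF forward_rule_frustrated]
    by (auto simp: frustrated_parking_function_def)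
  moreover have "(real n + 1) * real (card (staircase n n)) = real (2 * n choose n)"
    unfolding card_staircase_diagonal[symmetric] by (simp only: of_nat_mult of_nat_add of_nat_1)
  ultimately show "real (card {as. weakly_decreasing as \<and> frustrated_parking_function n as})
      = 1 / (real n + 1) * real ((2 * n) choose n)"
    by (simp add: field_simps)
qed

end
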